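(* For any local optimum $x$, with respect to the potentials $f_j$ with $\gamma=\frac{9+\sqrt5}{19}$, of the improved local search algorithm for $R\,||\sum w_jC_j$, there exists a feasible solution of (SDP-SR) with objective value at least $\frac{4}{5+\sqrt5}\,C(x)$.
   Context: $R\,||\sum w_jC_j$: a finite set $J$ of jobs with weights $w_j>0$, a finite set $M$ of machines, processing times $p_{ij}\in\mathbb R_{\ge0}\cup\{\infty\}$, and $\mathcal S_j=\{i\in M:p_{ij}<\infty\}\neq\emptyset$. Smith ratios: $\delta_{ij}=p_{ij}/w_j$. For each machine $i$, $\prec_i$ is a strict total order on $J$ such that $k\prec_i j$ implies $\delta_{ik}\le\delta_{ij}$ (ties broken consistently). An assignment is $x\in\{0,1\}^{M\times J}$ with $\sum_{i\in\mathcal S_j}x_{ij}=1$ and $x_{ij}=0$ for $i\notin\mathcal S_j$, for every $j\in J$. Completion times: $C_j(x)=\sum_{i\in M}x_{ij}\big(p_{ij}+\sum_{k\prec_i j}p_{ik}x_{ik}\big)$ (terms with a zero factor $x$ are $0$). Cost: $C(x)=\sum_{j\in J}w_jC_j(x)$. Local search. For $\gamma=(9+\sqrt5)/19$ define for each job $j$ the potential $$f_j(x)=\sum_{i\in M}x_{ij}\Big(w_jp_{ij}+\gamma\sum_{k\ne j}w_jw_k\min\{\delta_{ij},\delta_{ik}\}\,x_{ik}\Big).$$ The algorithm moves a job $j$ to a different feasible machine when this strictly decreases $f_j$. A local optimum is an assignment $x$ in which no job $j$ can strictly decrease $f_j$ by moving to another feasible machine (the other jobs staying fixed). (SDP-SR):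 the variables are reals $y_j$ $(j\in J)$ and vectors $v_0,v_{ij}\in\mathbb R^d$ $(j\in J,i\in\mathcal S_j)$ for some $d\in\mathbb N$, with the standard inner product. Maximize $\sum_{j\in J}y_j-\frac12\|v_0\|^2$ subject to $y_j\le w_jp_{ij}-\frac12\|v_{ij}\|^2+\langle v_0,v_{ij}\rangle$ for all $j\in J$, $i\in\mathcal S_j$; and $\langle v_{ij},v_{i'k}\rangle\le w_jw_k\min\{\delta_{ij},\delta_{ik}\}\,\mathbf 1_{\{i=i'\}}$ for all $(i,j)\ne(i',k)$ with $j,k\in J$, $i\in\mathcal S_j$, $i'\in\mathcal S_k$ (right-hand side $0$ if $i\ne i'$). *)

theory Defs
  imports "HOL-Library.Extended_Real" "Jordan_Normal_Form.Matrix"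
begin

(* Processing times live in ereal because p i j may be infinite. In ereal one has
   0 * \<infinity> = 0, so products with a zero entry of x vanish as they should. *)

definition feasible_machines :: "'m set \<Rightarrow> ('m \<Rightarrow> 'j \<Rightarrow> ereal) \<Rightarrow> 'j \<Rightarrow> 'm set" where
  "feasible_machines M p j = {i \<in> M. p i j < \<infinity>}"

definition smith_ratio :: "('m \<Rightarrow> 'j \<Rightarrow> ereal) \<Rightarrow> ('j \<Rightarrow> real) \<Rightarrow> 'm \<Rightarrow> 'j \<Rightarrow> ereal" where
  "smith_ratio p w i j = p i j / ereal (w j)"

definition scheduling_instance ::
    "'j set \<Rightarrow> 'm set \<Rightarrow> ('j \<Rightarrow> real) \<Rightarrow> ('m \<Rightarrow> 'j \<Rightarrow> ereal) \<Rightarrow> bool" where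
  "scheduling_instance J M w p \<longleftrightarrow>
     finite J \<and> finite M \<and> (\<forall>j\<in>J. w j > 0) \<and> (\<forall>i\<in>M. \<forall>j\<in>J. p i j \<ge> 0) \<and>
     (\<forall>j\<in>J. feasible_machines M p j \<noteq> {})"

(* prec i k j means that k precedes j on machine i. *)
definition smith_orders ::
    "'j set \<Rightarrow> 'm set \<Rightarrow> ('j \<Rightarrow> real) \<Rightarrow> ('m \<Rightarrow> 'j \<Rightarrow> ereal) \<Rightarrow> ('m \<Rightarrow> 'j \<Rightarrow> 'j \<Rightarrow> bool) \<Rightarrow> bool" where
  "smith_orders J M w p prec \<longleftrightarrow>
     (\<forall>i\<in>M. irreflp_on J (prec i) \<and> transp_on J (prec i) \<and> totalp_on J (prec i) \<and>
       (\<forall>k\<in>J. \<forall>j\<in>J. prec i k j \<longrightarrow> smith_ratio p w i k \<le> smith_ratio p w i j))"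

definition assignment ::
    "'j set \<Rightarrow> 'm set \<Rightarrow> ('m \<Rightarrow> 'j \<Rightarrow> ereal) \<Rightarrow> ('m \<Rightarrow> 'j \<Rightarrow> real) \<Rightarrow> bool" where
  "assignment J M p x \<longleftrightarrow>
     (\<forall>i\<in>M. \<forall>j\<in>J. x i j \<in> {0, 1}) \<and>
     (\<forall>j\<in>J. (\<Sum>i\<in>feasible_machines M p j. x i j) = 1 \<and>
            (\<forall>i\<in>M - feasible_machines M p j. x i j = 0))"

definition completion_time ::
    "'j set \<Rightarrow> 'm set \<Rightarrow> ('m \<Rightarrow> 'j \<Rightarrow> ereal) \<Rightarrow> ('m \<Rightarrow> 'j \<Rightarrow> 'j \<Rightarrow> bool) \<Rightarrow>
     ('m \<Rightarrow> 'j \<Rightarrow> real) \<Rightarrow> 'j \<Rightarrow> ereal" where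
  "completion_time J M p prec x j =
     (\<Sum>i\<in>M. ereal (x i j) * (p i j + (\<Sum>k\<in>{k \<in> J. prec i k j}. p i k * ereal (x i k))))"

definition cost ::
    "'j set \<Rightarrow> 'm set \<Rightarrow> ('j \<Rightarrow> real) \<Rightarrow> ('m \<Rightarrow> 'j \<Rightarrow> ereal) \<Rightarrow> ('m \<Rightarrow> 'j \<Rightarrow> 'j \<Rightarrow> bool) \<Rightarrow>
     ('m \<Rightarrow> 'j \<Rightarrow> real) \<Rightarrow> ereal" where
  "cost J M w p prec x = (\<Sum>j\<in>J. ereal (w j) * completion_time J M p prec x j)"

definition potential ::
    "real \<Rightarrow> 'j set \<Rightarrow> 'm set \<Rightarrow> ('j \<Rightarrow> real) \<Rightarrow> ('m \<Rightarrow> 'j \<Rightarrow> ereal) \<Rightarrow>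
     ('m \<Rightarrow> 'j \<Rightarrow> real) \<Rightarrow> 'j \<Rightarrow> ereal" where
  "potential \<gamma> J M w p x j =
     (\<Sum>i\<in>M. ereal (x i j) *
       (ereal (w j) * p i j +
        ereal \<gamma> * (\<Sum>k\<in>J - {j}. ereal (w j * w k) *
                     min (smith_ratio p w i j) (smith_ratio p w i k) * ereal (x i k))))"

definition move_job :: "('m \<Rightarrow> 'j \<Rightarrow> real) \<Rightarrow> 'j \<Rightarrow> 'm \<Rightarrow> 'm \<Rightarrow> 'j \<Rightarrow> real" where
  "move_job x j i' = (\<lambda>i k. if k = j then (if i = i' then 1 else 0) else x i k)"

definition local_optimum ::
    "real \<Rightarrow> 'j set \<Rightarrow> 'm set \<Rightarrow> ('j \<Rightarrow> real) \<Rightarrow> ('m \<Rightarrow> 'j \<Rightarrow> ereal) \<Rightarrow> ('m \<Rightarrow> 'j \<Rightarrow> real) \<Rightarrow> bool" where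
  "local_optimum \<gamma> J M w p x \<longleftrightarrow>
     assignment J M p x \<and>
     \<not> (\<exists>j\<in>J. \<exists>i'\<in>feasible_machines M p j. x i' j = 0 \<and>
          potential \<gamma> J M w p (move_job x j i') j < potential \<gamma> J M w p x j)"

(* The vectors have an arbitrary dimension d, hence the carrier-based vectors; the squared
   Euclidean norm is the scalar product of a vector with itself. *)
definition sdp_feasible ::
    "'j set \<Rightarrow> 'm set \<Rightarrow> ('j \<Rightarrow> real) \<Rightarrow> ('m \<Rightarrow> 'j \<Rightarrow> ereal) \<Rightarrow>
     nat \<Rightarrow> ('j \<Rightarrow> real) \<Rightarrow> real vec \<Rightarrow> ('m \<Rightarrow> 'j \<Rightarrow> real vec) \<Rightarrow> bool" where
  "sdp_feasible J M w p d y v0 v \<longleftrightarrow>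
     v0 \<in> carrier_vec d \<and>
     (\<forall>j\<in>J. \<forall>i\<in>feasible_machines M p j. v i j \<in> carrier_vec d) \<and>
     (\<forall>j\<in>J. \<forall>i\<in>feasible_machines M p j.
        ereal (y j) \<le> ereal (w j) * p i j
                      + ereal (- (1/2) * scalar_prod (v i j) (v i j) + scalar_prod v0 (v i j))) \<and>
     (\<forall>j\<in>J. \<forall>k\<in>J. \<forall>i\<in>feasible_machines M p j. \<forall>i'\<in>feasible_machines M p k.
        (i, j) \<noteq> (i', k) \<longrightarrow>
        ereal (scalar_prod (v i j) (v i' k)) \<le>
          (if i = i'
           then ereal (w j * w k) * min (smith_ratio p w i j) (smith_ratio p w i k)
           else 0))"

definition sdp_objective :: "'j set \<Rightarrow> ('j \<Rightarrow> real) \<Rightarrow> real vec \<Rightarrow> real" where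
  "sdp_objective J y v0 = (\<Sum>j\<in>J. y j) - (1/2) * scalar_prod v0 v0"

end

theory Submission
  imports Defs
begin

(* With i(j) the machine of job j, let phi_ij be w_j times the indicator function of [0, delta_ij]
   in the i-th of |M| orthogonal copies of L^2, so that <phi_ij, phi_ik> = w_j w_k min(delta_ij, delta_ik),
   and let X be the sum of the phi_{i(j) j}. The fitted solution is v_0 = alpha X, v_ij = beta phi_ij and
   y_j = c f_j(x), where beta^2 = (1 + sqrt 5)/5, c = 1 - beta^2/2 and alpha beta = c gamma = 2/5.
   Local optimality of j is then exactly the constraint on y_j for i \<noteq> i(j). With A the sum of
   the w_j p_{i(j) j} and B the sum of the interactions over ordered pairs sharing a machine,
   C(x) = A + B/2 and |X|^2 = A + B, and the objective is
   (c - alpha^2/2) A + (c gamma - alpha^2/2) B = (1 - 1/sqrt 5) C(x). *)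

section \<open>Finite-dimensional vectors with the kernel min as Gram matrix\<close>

text \<open>On \<open>V\<close>, \<open>g v\<close> is the gap between \<open>v\<close> and its
  predecessor, with 0 below the least element. These masses replace Lebesgue measure on an interval:
  the initial segment up to \<open>m\<close> has mass \<open>m\<close>, since the gaps
  telescope.\<close>

lemma finite_gap_decomposition:
  fixes V :: "real set"
  assumes "finite V" and "\<And>v. v \<in> V \<Longrightarrow> v \<ge> 0"
  shows "\<exists>g. (\<forall>v. g v \<ge> 0) \<and> (\<forall>m\<in>V. (\<Sum>v\<in>{v \<in> V. v \<le> m}. g v) = m)"
  using assms
proof (induction rule: finite_linorder_max_induct)
  case empty
  show ?case by (intro exI[of _ "\<lambda>_. 0"]) auto
next
  case (insert b A)
  then obtain g where g: "\<forall>v. g v \<ge> (0::real)" "\<forall>m\<in>A. (\<Sum>v\<in>{v \<in> A. v \<le> m}. g v) = m"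
    by auto
  \<comment> \<open>The mass of \<open>A\<close> is its maximum, or 0 if \<open>A\<close> is empty,
    so the new gap \<open>b - sum g A\<close> is nonnegative.\<close>
  have le: "sum g A \<le> b"
  proof (cases "A = {}")
    case True
    then show ?thesis using insert.prems by simp
  next
    case False
    then have M: "Max A \<in> A" using insert.hyps by simp
    have "{v \<in> A. v \<le> Max A} = A" using insert.hyps by auto
    then have "sum g A = Max A" using g(2) M by force
    then show ?thesis using M insert.hyps by force
  qed
  have nb: "b \<notin> A" using insert.hyps by auto
  define g' where "g' = g(b := b - sum g A)"
  have "(\<Sum>v\<in>{v \<in> insert b A. v \<le> m}. g' v) = m" if m: "m \<in> insert b A" for m
  proof (cases "m = b")
    case True
    then have "{v \<in> insert b A. v \<le> m} = insert b A" using insert.hyps by force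
    moreover have "sum g' A = sum g A" unfolding g'_def using nb by (intro sum.cong) auto
    ultimately show ?thesis using nb insert.hyps True by (simp add: g'_def)
  next
    case False
    then have mA: "m \<in> A" using m by simp
    then have "{v \<in> insert b A. v \<le> m} = {v \<in> A. v \<le> m}" using insert.hyps by force
    moreover have "(\<Sum>v\<in>{v \<in> A. v \<le> m}. g' v) = (\<Sum>v\<in>{v \<in> A. v \<le> m}. g v)"
      unfolding g'_def using nb by (intro sum.cong) auto
    ultimately show ?thesis using g(2) mA by simp
  qed
  moreover have "\<forall>v. g' v \<ge> 0" using g(1) le by (simp add: g'_def)
  ultimately show ?case by blast
qed

text \<open>Discretised indicators of the intervals [0, \<open>a i j\<close>], one orthogonal block
  of coordinates per machine: two of them on the same machine overlap exactly up to the smaller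
  endpoint.\<close>

lemma min_kernel_gram:
  fixes a :: "'m \<Rightarrow> 'j \<Rightarrow> real"
  assumes "finite M" "finite J" and nonneg: "\<And>i j. i \<in> M \<Longrightarrow> j \<in> J \<Longrightarrow> a i j \<ge> 0"
  shows "\<exists>(d::nat) F. \<forall>i\<in>M. \<forall>i'\<in>M. \<forall>j\<in>J. \<forall>k\<in>J.
    (\<Sum>r<d. F i j r * F i' k r) = (if i = i' then min (a i j) (a i k) else 0)"
proof -
  define V where "V = case_prod a ` (M \<times> J)"
  have fV: "finite V" using assms by (simp add: V_def)
  have "\<And>v. v \<in> V \<Longrightarrow> v \<ge> 0" using nonneg by (auto simp: V_def)
  from finite_gap_decomposition[OF fV this] obtain g where
    g: "\<And>v. g v \<ge> 0" "\<And>m. m \<in> V \<Longrightarrow> (\<Sum>v\<in>{v \<in> V. v \<le> m}. g v) = m" by blast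
  \<comment> \<open>Coordinates are pairs of a machine and an endpoint. The square root makes a
    product of two entries contribute the mass \<open>g v\<close>; \<open>h\<close> below numbers
    the pairs.\<close>
  define G where "G i j = (\<lambda>(l, v). if i = l \<and> v \<le> a i j then sqrt (g v) else 0)" for i j
  have fin: "finite (M \<times> V)" using assms fV by simp
  then obtain h where h: "bij_betw h {0..<card (M \<times> V)} (M \<times> V)"
    using ex_bij_betw_nat_finite by blast
  have "(\<Sum>r<card (M \<times> V). G i j (h r) * G i' k (h r)) =
      (if i = i' then min (a i j) (a i k) else 0)"
    if "i \<in> M" "i' \<in> M" "j \<in> J" "k \<in> J" for i i' j k
  proof -
    have "(\<Sum>r<card (M \<times> V). G i j (h r) * G i' k (h r)) = (\<Sum>z\<in>M \<times> V. G i j z * G i' k z)"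
      using sum.reindex_bij_betw[OF h, of "\<lambda>z. G i j z * G i' k z"]
      by (simp add: lessThan_atLeast0)
    also have "\<dots> = (\<Sum>l\<in>M. \<Sum>v\<in>V. G i j (l, v) * G i' k (l, v))"
      by (simp add: sum.cartesian_product)
    also have "\<dots> = (\<Sum>l\<in>M. if l = i then
        (if i = i' then \<Sum>v\<in>V. if v \<le> min (a i j) (a i k) then g v else 0 else 0) else 0)"
      by (intro sum.cong) (auto simp: G_def g(1) intro!: sum.cong sum.neutral)
    also have "\<dots> = (if i = i' then \<Sum>v\<in>V. if v \<le> min (a i j) (a i k) then g v else 0 else 0)"
      using that assms by simp
    also have "(\<Sum>v\<in>V. if v \<le> min (a i j) (a i k) then g v else 0) =
        (\<Sum>v\<in>{v \<in> V. v \<le> min (a i j) (a i k)}. g v)"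
      using fV by (simp add: sum.If_cases Int_def)
    \<comment> \<open>The minimum is one of the two endpoints, hence lies in \<open>V\<close>, where
      the masses up to it telescope.\<close>
    also have "\<dots> = min (a i j) (a i k)"
      using that by (intro g(2)) (auto simp: V_def min_def)
    finally show ?thesis .
  qed
  then show ?thesis by (intro exI[of _ "card (M \<times> V)"] exI[of _ "\<lambda>i j r. G i j (h r)"]) blast
qed

section \<open>Assignments, potentials and local optimality in real numbers\<close>

lemma assignment_machine:
  assumes "assignment J M p x" "finite M"
  obtains s where "\<And>j. j \<in> J \<Longrightarrow> s j \<in> feasible_machines M p j"
    and "\<And>i j. i \<in> M \<Longrightarrow> j \<in> J \<Longrightarrow> x i j = (if i = s j then 1 else 0)"
proof -
  have "\<exists>s. s \<in> feasible_machines M p j \<and> (\<forall>i\<in>M. x i j = (if i = s then 1 else 0))"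
    if j: "j \<in> J" for j
  proof -
    let ?F = "feasible_machines M p j"
    have FM: "?F \<subseteq> M" by (auto simp: feasible_machines_def)
    then have fF: "finite ?F" using assms(2) finite_subset by blast
    have x01: "\<And>i. i \<in> M \<Longrightarrow> x i j \<in> {0, 1}" and one: "(\<Sum>i\<in>?F. x i j) = 1"
      and out: "\<And>i. i \<in> M - ?F \<Longrightarrow> x i j = 0"
      using assms(1) j by (auto simp: assignment_def)
    from one obtain s where s: "s \<in> ?F" "x s j \<noteq> 0"
      by (metis sum.neutral zero_neq_one)
    then have xs: "x s j = 1" using x01 FM by blast
    have "(\<Sum>i\<in>?F - {s}. x i j) = 0" using one xs sum.remove[OF fF s(1), of "\<lambda>i. x i j"] by simp
    then have "\<forall>i\<in>?F - {s}. x i j = 0"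
      using fF x01 FM by (subst (asm) sum_nonneg_eq_0_iff) force+
    then show ?thesis using s xs out by auto
  qed
  then show thesis using that by metis
qed

text \<open>If \<open>k\<close> has the smaller Smith ratio, this is \<open>w j * q i k\<close>, the
  weighted delay that \<open>k\<close> causes to \<open>j\<close>. Below, \<open>q\<close> is
  \<open>real_of_ereal\<close> of \<open>p\<close>, which sends \<infinity> to 0, so it represents
  \<open>p\<close> faithfully only on feasible machines.\<close>

definition interaction :: "('j \<Rightarrow> real) \<Rightarrow> ('m \<Rightarrow> 'j \<Rightarrow> real) \<Rightarrow> 'm \<Rightarrow> 'j \<Rightarrow> 'j \<Rightarrow> real" where
  "interaction w q i j k = w j * w k * min (q i j / w j) (q i k / w k)"

text \<open>The machine \<open>i\<close> need not be \<open>s j\<close>. As \<open>j\<close> itself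
  is left out of the sum, the value does not depend on where \<open>j\<close> sits, and the same
  \<open>s\<close> serves before and after a move of \<open>j\<close>.\<close>

definition machine_interaction ::
    "'j set \<Rightarrow> ('j \<Rightarrow> real) \<Rightarrow> ('m \<Rightarrow> 'j \<Rightarrow> real) \<Rightarrow> ('j \<Rightarrow> 'm) \<Rightarrow> 'm \<Rightarrow> 'j \<Rightarrow> real" where
  "machine_interaction J w q s i j = (\<Sum>k\<in>J - {j}. if i = s k then interaction w q i j k else 0)"

lemma interaction_commute: "interaction w q i j k = interaction w q i k j"
  by (simp add: interaction_def min.commute mult.commute)

lemma interaction_self: "w j > 0 \<Longrightarrow> interaction w q i j j = w j * q i j"
  by (simp add: interaction_def)

lemma interaction_nonneg:
  "w j > 0 \<Longrightarrow> w k > 0 \<Longrightarrow> q i j \<ge> 0 \<Longrightarrow> q i k \<ge> 0 \<Longrightarrow> interaction w q i j k \<ge> 0"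
  by (simp add: interaction_def)

lemma feasible_machine_time:
  assumes "scheduling_instance J M w p" "j \<in> J" "i \<in> feasible_machines M p j"
  shows "i \<in> M" "p i j = ereal (real_of_ereal (p i j))" "real_of_ereal (p i j) \<ge> 0"
proof -
  show i: "i \<in> M" using assms by (simp add: feasible_machines_def)
  have "p i j \<ge> 0" "p i j < \<infinity>"
    using assms i by (auto simp: scheduling_instance_def feasible_machines_def)
  then show "p i j = ereal (real_of_ereal (p i j))" "real_of_ereal (p i j) \<ge> 0"
    by (cases "p i j"; simp)+
qed

lemma smith_ratio_ereal:
  "w j > 0 \<Longrightarrow> p i j = ereal r \<Longrightarrow> smith_ratio p w i j = ereal (r / w j)"
  by (simp add: smith_ratio_def)

lemma smith_ratio_interaction:
  assumes inst: "scheduling_instance J M w p" and "j \<in> J" "k \<in> J"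
    and "i \<in> feasible_machines M p j" "i \<in> feasible_machines M p k"
  shows "ereal (w j * w k) * min (smith_ratio p w i j) (smith_ratio p w i k) =
    ereal (interaction w (\<lambda>i j. real_of_ereal (p i j)) i j k)"
proof -
  have "w j > 0" "w k > 0" using assms by (auto simp: scheduling_instance_def)
  then have "smith_ratio p w i j = ereal (real_of_ereal (p i j) / w j)"
    "smith_ratio p w i k = ereal (real_of_ereal (p i k) / w k)"
    using smith_ratio_ereal feasible_machine_time(2)[OF inst] assms by metis+
  then show ?thesis by (simp add: interaction_def min_def)
qed

text \<open>The matrix \<open>z\<close> has \<open>j\<close> on an arbitrary feasible machine
  \<open>i\<close> and every other job where \<open>s\<close> puts it. This covers both
  \<open>x\<close> and \<open>move_job x j i\<close>.\<close>

lemma potential_single_machine: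
  assumes inst: "scheduling_instance J M w p" and j: "j \<in> J" and i: "i \<in> feasible_machines M p j"
    and s: "\<And>k. k \<in> J \<Longrightarrow> s k \<in> feasible_machines M p k"
    and zj: "\<And>l. l \<in> M \<Longrightarrow> z l j = (if l = i then 1 else 0)"
    and zk: "\<And>l k. l \<in> M \<Longrightarrow> k \<in> J - {j} \<Longrightarrow> z l k = (if l = s k then 1 else 0)"
  defines "q \<equiv> \<lambda>i j. real_of_ereal (p i j)"
  shows "potential \<gamma> J M w p z j = ereal (w j * q i j + \<gamma> * machine_interaction J w q s i j)"
proof -
  have iM: "i \<in> M" and pij: "p i j = ereal (q i j)"
    using feasible_machine_time[OF inst j i] by (auto simp: q_def)
  have fM: "finite M" using inst by (simp add: scheduling_instance_def)
  let ?t = "\<lambda>l. ereal (w j) * p l j +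
        ereal \<gamma> * (\<Sum>k\<in>J - {j}. ereal (w j * w k) *
                     min (smith_ratio p w l j) (smith_ratio p w l k) * ereal (z l k))"
  \<comment> \<open>Off machine \<open>i\<close> the bracket may be infinite, but its factor
    \<open>z l j\<close> is 0 and 0 * \<infinity> = 0.\<close>
  have "potential \<gamma> J M w p z j = (\<Sum>l\<in>M. if l = i then ?t l else 0)"
    unfolding potential_def by (intro sum.cong) (auto simp: zj)
  also have "\<dots> = ?t i" using fM iM by simp
  also have "(\<Sum>k\<in>J - {j}. ereal (w j * w k) *
                     min (smith_ratio p w i j) (smith_ratio p w i k) * ereal (z i k)) =
      (\<Sum>k\<in>J - {j}. ereal (if i = s k then interaction w q i j k else 0))"
  proof (rule sum.cong[OF refl])
    fix k assume k: "k \<in> J - {j}"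
    show "ereal (w j * w k) * min (smith_ratio p w i j) (smith_ratio p w i k) * ereal (z i k) =
        ereal (if i = s k then interaction w q i j k else 0)"
    proof (cases "i = s k")
      case True
      then have "i \<in> feasible_machines M p k" using s k by auto
      then show ?thesis
        using smith_ratio_interaction[OF inst j _ i, of k] zk[OF iM k] k True
        by (simp add: q_def)
    qed (use zk[OF iM k] in \<open>simp flip: zero_ereal_def\<close>)
  qed
  finally show ?thesis by (simp add: pij machine_interaction_def)
qed

text \<open>Both potentials are evaluated by \<open>potential_single_machine\<close>. The trivial
  case \<open>i = s j\<close> is included so that the bound on \<open>y j\<close> can be derived
  uniformly over all feasible machines.\<close>

lemma local_optimum_inequality:
  assumes inst: "scheduling_instance J M w p" and opt: "local_optimum \<gamma> J M w p x"
    and s: "\<And>k. k \<in> J \<Longrightarrow> s k \<in> feasible_machines M p k"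
    and x: "\<And>l k. l \<in> M \<Longrightarrow> k \<in> J \<Longrightarrow> x l k = (if l = s k then 1 else 0)"
    and j: "j \<in> J" and i: "i \<in> feasible_machines M p j"
  defines "q \<equiv> \<lambda>i j. real_of_ereal (p i j)"
  shows "w j * q (s j) j + \<gamma> * machine_interaction J w q s (s j) j
    \<le> w j * q i j + \<gamma> * machine_interaction J w q s i j"
proof (cases "i = s j")
  case False
  have "i \<in> M" using i by (simp add: feasible_machines_def)
  then have "x i j = 0" using x j False by simp
  then have "\<not> potential \<gamma> J M w p (move_job x j i) j < potential \<gamma> J M w p x j"
    using opt j i by (auto simp: local_optimum_def)
  moreover have "potential \<gamma> J M w p x j =
      ereal (w j * q (s j) j + \<gamma> * machine_interaction J w q s (s j) j)"
    unfolding q_def by (rule potential_single_machine[OF inst j s[OF j] s]) (use x j in auto)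
  moreover have "potential \<gamma> J M w p (move_job x j i) j =
      ereal (w j * q i j + \<gamma> * machine_interaction J w q s i j)"
    unfolding q_def
    by (rule potential_single_machine[OF inst j i s]) (use x in \<open>auto simp: move_job_def\<close>)
  ultimately show ?thesis by simp
qed simp

section \<open>The cost as a sum of pairwise interactions\<close>

text \<open>In each pair of jobs sharing a machine, exactly the later one waits, and its weighted
  waiting time is the interaction of the pair. The sum over ordered pairs counts this twice, hence
  the division by 2.\<close>

lemma cost_eq_interactions:
  assumes inst: "scheduling_instance J M w p" and ord: "smith_orders J M w p prec"
    and s: "\<And>k. k \<in> J \<Longrightarrow> s k \<in> feasible_machines M p k"
    and x: "\<And>l k. l \<in> M \<Longrightarrow> k \<in> J \<Longrightarrow> x l k = (if l = s k then 1 else 0)"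
  defines "q \<equiv> \<lambda>i j. real_of_ereal (p i j)"
  shows "cost J M w p prec x = ereal ((\<Sum>j\<in>J. w j * q (s j) j) +
    (\<Sum>j\<in>J. machine_interaction J w q s (s j) j) / 2)"
proof -
  have fM: "finite M" and fJ: "finite J" and w: "\<And>j. j \<in> J \<Longrightarrow> w j > 0"
    using inst by (auto simp: scheduling_instance_def)
  have sM: "s j \<in> M" and psj: "p (s j) j = ereal (q (s j) j)" if "j \<in> J" for j
    using feasible_machine_time[OF inst that s[OF that]] by (auto simp: q_def)
  \<comment> \<open>\<open>P j k\<close> is the weighted delay of \<open>j\<close> caused by
    \<open>k\<close>.\<close>
  define P where "P j k = (if s j = s k \<and> prec (s j) k j then interaction w q (s j) j k else 0)" for j k
  have ct: "ereal (w j) * completion_time J M p prec x j = ereal (w j * q (s j) j + (\<Sum>k\<in>J. P j k))"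
    if j: "j \<in> J" for j
  proof -
    let ?t = "\<lambda>l. p l j + (\<Sum>k\<in>{k \<in> J. prec l k j}. p l k * ereal (x l k))"
    have "completion_time J M p prec x j = (\<Sum>l\<in>M. if l = s j then ?t l else 0)"
      unfolding completion_time_def by (intro sum.cong) (auto simp: x j)
    also have "\<dots> = ?t (s j)" using fM sM j by simp
    also have "(\<Sum>k\<in>{k \<in> J. prec (s j) k j}. p (s j) k * ereal (x (s j) k)) =
        (\<Sum>k\<in>{k \<in> J. prec (s j) k j}. ereal (P j k / w j))"
    proof (rule sum.cong[OF refl])
      fix k assume "k \<in> {k \<in> J. prec (s j) k j}"
      then have k: "k \<in> J" and pr: "prec (s j) k j" by auto
      show "p (s j) k * ereal (x (s j) k) = ereal (P j k / w j)"
      proof (cases "s j = s k")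
        case True
        \<comment> \<open>The Smith order makes the ratio of the earlier job \<open>k\<close> the
          minimum in the interaction.\<close>
        have "smith_ratio p w (s j) k \<le> smith_ratio p w (s j) j"
          using ord sM[OF j] k j pr by (auto simp: smith_orders_def)
        then have "q (s j) k / w k \<le> q (s j) j / w j"
          using smith_ratio_ereal[where w = w and p = p and i = "s j", OF w[OF j] psj[OF j]]
            smith_ratio_ereal[where w = w and p = p and i = "s k", OF w[OF k] psj[OF k]] True by simp
        then have "P j k = w j * q (s j) k"
          using w[OF j] w[OF k] True pr by (simp add: P_def interaction_def min_def)
        then show ?thesis using w[OF j] x[OF sM[OF j] k] True psj[OF k] by simp
      next
        case False
        then show ?thesis using x[OF sM[OF j] k] by (simp add: P_def flip: zero_ereal_def)
      qed
    qed
    also have "(\<Sum>k\<in>{k \<in> J. prec (s j) k j}. ereal (P j k / w j)) = ereal ((\<Sum>k\<in>J. P j k) / w j)"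
    proof -
      have "(\<Sum>k\<in>{k \<in> J. prec (s j) k j}. P j k / w j) = (\<Sum>k\<in>J. P j k / w j)"
        using fJ by (intro sum.mono_neutral_left) (auto simp: P_def)
      then show ?thesis by (simp add: sum_divide_distrib)
    qed
    finally show ?thesis using w[OF j] psj[OF j] by (simp add: distrib_left)
  qed
  \<comment> \<open>For distinct jobs on one machine exactly one of the two orders holds, so one of
    \<open>P j k\<close>, \<open>P k j\<close> is the interaction and the other is 0. On the
    diagonal both vanish by irreflexivity.\<close>
  have "machine_interaction J w q s (s j) j = (\<Sum>k\<in>J. P j k + P k j)" if j: "j \<in> J" for j
  proof -
    have irr: "\<not> prec (s j) k k" if "k \<in> J" for k
      using ord sM[OF j] that by (auto simp: smith_orders_def irreflp_on_def)
    have "machine_interaction J w q s (s j) j = (\<Sum>k\<in>J - {j}. P j k + P k j)"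
      unfolding machine_interaction_def
    proof (rule sum.cong[OF refl])
      fix k assume k: "k \<in> J - {j}"
      then have "prec (s j) k j \<or> prec (s j) j k"
        using ord sM[OF j] j by (auto simp: smith_orders_def totalp_on_def)
      moreover have "\<not> (prec (s j) k j \<and> prec (s j) j k)"
        using ord sM[OF j] j k irr[OF j] unfolding smith_orders_def transp_on_def by blast
      ultimately show "(if s j = s k then interaction w q (s j) j k else 0) = P j k + P k j"
        by (auto simp: P_def interaction_commute)
    qed
    also have "\<dots> = (\<Sum>k\<in>J. P j k + P k j)"
      using fJ irr[OF j] by (intro sum.mono_neutral_left) (auto simp: P_def)
    finally show ?thesis .
  qed
  then have "(\<Sum>j\<in>J. machine_interaction J w q s (s j) j) = (\<Sum>j\<in>J. \<Sum>k\<in>J. P j k) + (\<Sum>j\<in>J. \<Sum>k\<in>J. P k j)"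
    by (simp add: sum.distrib)
  also have "(\<Sum>j\<in>J. \<Sum>k\<in>J. P k j) = (\<Sum>j\<in>J. \<Sum>k\<in>J. P j k)" by (rule sum.swap)
  finally have "(\<Sum>j\<in>J. machine_interaction J w q s (s j) j) / 2 = (\<Sum>j\<in>J. \<Sum>k\<in>J. P j k)" by simp
  moreover have "cost J M w p prec x = (\<Sum>j\<in>J. ereal (w j * q (s j) j + (\<Sum>k\<in>J. P j k)))"
    unfolding cost_def by (intro sum.cong) (simp_all add: ct)
  ultimately show ?thesis by (simp add: sum.distrib)
qed

section \<open>Construction and value of the SDP solution\<close>

text \<open>Scaling the vector of job \<open>j\<close> by \<open>w j\<close> turns the kernel min of
  the Smith ratios into the interaction. Infinite processing times have become 0 in
  \<open>q\<close>, so the nonnegativity that \<open>min_kernel_gram\<close> asks for holds on all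
  of \<open>M\<close> and \<open>J\<close>.\<close>

lemma interaction_gram:
  assumes inst: "scheduling_instance J M w p"
  defines "q \<equiv> \<lambda>i j. real_of_ereal (p i j)"
  shows "\<exists>(d::nat) F. \<forall>i\<in>M. \<forall>i'\<in>M. \<forall>j\<in>J. \<forall>k\<in>J.
    (\<Sum>r<d. F i j r * F i' k r) = (if i = i' then interaction w q i j k else 0)"
proof -
  have fM: "finite M" and fJ: "finite J" and w: "\<And>j. j \<in> J \<Longrightarrow> w j > 0"
    and "\<And>i j. i \<in> M \<Longrightarrow> j \<in> J \<Longrightarrow> p i j \<ge> 0"
    using inst by (auto simp: scheduling_instance_def)
  then have "\<And>i j. i \<in> M \<Longrightarrow> j \<in> J \<Longrightarrow> q i j / w j \<ge> 0"
    by (simp add: q_def real_of_ereal_pos less_imp_le)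
  from min_kernel_gram[of M J "\<lambda>i j. q i j / w j", OF fM fJ this]
  obtain d G where G: "\<forall>i\<in>M. \<forall>i'\<in>M. \<forall>j\<in>J. \<forall>k\<in>J. (\<Sum>r<(d::nat). G i j r * G i' k r) =
    (if i = i' then min (q i j / w j) (q i k / w k) else 0)"
    by blast
  have "(\<Sum>r<d. (w j * G i j r) * (w k * G i' k r)) = (if i = i' then interaction w q i j k else 0)"
    if "i \<in> M" "i' \<in> M" "j \<in> J" "k \<in> J" for i i' j k
  proof -
    have "(\<Sum>r<d. (w j * G i j r) * (w k * G i' k r)) = w j * w k * (\<Sum>r<d. G i j r * G i' k r)"
      by (simp add: sum_distrib_left mult_ac)
    then show ?thesis using G that by (simp add: interaction_def)
  qed
  then show ?thesis by (intro exI[of _ d] exI[of _ "\<lambda>i j r. w j * G i j r"]) blast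
qed

lemma scalar_prod_vec: "scalar_prod (vec d f) (vec d g) = (\<Sum>r<d. f r * g r)"
  by (simp add: scalar_prod_def lessThan_atLeast0)

theorem theorem6p5:
  fixes J :: "'j set" and M :: "'m set"
    and w :: "'j \<Rightarrow> real" and p :: "'m \<Rightarrow> 'j \<Rightarrow> ereal"
    and prec :: "'m \<Rightarrow> 'j \<Rightarrow> 'j \<Rightarrow> bool"
    and x :: "'m \<Rightarrow> 'j \<Rightarrow> real"
  assumes "scheduling_instance J M w p"
    and "smith_orders J M w p prec"
    and "local_optimum ((9 + sqrt 5) / 19) J M w p x"
  shows "\<exists>d y v0 v. sdp_feasible J M w p d y v0 v \<and>
           ereal (sdp_objective J y v0) \<ge> ereal (4 / (5 + sqrt 5)) * cost J M w p prec x"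
proof -
  note inst = assms(1) and ord = assms(2) and opt = assms(3)
  define \<gamma> where "\<gamma> = (9 + sqrt 5) / 19"
  define q where "q = (\<lambda>i j. real_of_ereal (p i j))"
  have fM: "finite M" and fJ: "finite J" and w: "\<And>j. j \<in> J \<Longrightarrow> w j > 0"
    using inst by (auto simp: scheduling_instance_def)
  have "assignment J M p x" using opt by (simp add: local_optimum_def)
  from assignment_machine[OF this fM] obtain s
    where s: "\<And>j. j \<in> J \<Longrightarrow> s j \<in> feasible_machines M p j"
      and x: "\<And>i j. i \<in> M \<Longrightarrow> j \<in> J \<Longrightarrow> x i j = (if i = s j then 1 else 0)" by blast
  let ?h = "interaction w q" and ?T = "machine_interaction J w q s"
  obtain d F where F: "\<And>i i' j k. i \<in> M \<Longrightarrow> i' \<in> M \<Longrightarrow> j \<in> J \<Longrightarrow> k \<in> J \<Longrightarrow>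
    (\<Sum>r<(d::nat). F i j r * F i' k r) = (if i = i' then ?h i j k else 0)"
    using interaction_gram[OF inst] unfolding q_def by metis
  have feas: "i \<in> M" "p i j = ereal (q i j)" "q i j \<ge> 0"
    if "j \<in> J" "i \<in> feasible_machines M p j" for i j
    using feasible_machine_time[OF inst that] by (auto simp: q_def)
  define X where "X r = (\<Sum>k\<in>J. F (s k) k r)" for r
  \<comment> \<open>The summand \<open>k = j\<close> of \<open>X\<close> is split off: it
    contributes only if \<open>i = s j\<close>, and then gives the squared norm
    \<open>w j * q i j\<close>.\<close>
  have FX: "(\<Sum>r<d. X r * F i j r) = ?T i j + (if i = s j then w j * q i j else 0)"
    if j: "j \<in> J" and i: "i \<in> M" for i j
  proof -
    have "(\<Sum>r<d. X r * F i j r) = (\<Sum>r<d. \<Sum>k\<in>J. F i j r * F (s k) k r)"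
      by (simp add: X_def sum_distrib_left mult.commute)
    also have "\<dots> = (\<Sum>k\<in>J. \<Sum>r<d. F i j r * F (s k) k r)" by (rule sum.swap)
    also have "\<dots> = (\<Sum>k\<in>J. if i = s k then ?h i j k else 0)"
      using F feas(1) s i j by (intro sum.cong) auto
    also have "\<dots> = ?T i j + (if i = s j then w j * q i j else 0)"
      using fJ j w by (simp add: machine_interaction_def sum.remove interaction_self)
    finally show ?thesis .
  qed
  define A where "A = (\<Sum>j\<in>J. w j * q (s j) j)"
  define B where "B = (\<Sum>j\<in>J. ?T (s j) j)"
  have XX: "(\<Sum>r<d. X r * X r) = A + B"
  proof -
    have "(\<Sum>r<d. X r * X r) = (\<Sum>r<d. \<Sum>j\<in>J. X r * F (s j) j r)"
      by (subst (2) X_def) (simp add: sum_distrib_left)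
    also have "\<dots> = (\<Sum>j\<in>J. \<Sum>r<d. X r * F (s j) j r)" by (rule sum.swap)
    also have "\<dots> = (\<Sum>j\<in>J. ?T (s j) j + w j * q (s j) j)"
      using FX feas(1) s by (intro sum.cong) auto
    finally show ?thesis by (simp add: A_def B_def sum.distrib)
  qed
  \<comment> \<open>The objective is a multiple of A + B/2 when its coefficient of B is half that of
    A, which with c = 1 - \<beta>^2/2 and c \<gamma> = \<alpha> \<beta> reads \<beta>^2 + 4 \<alpha>
    \<beta> - \<alpha>^2 = 2. The factor 1 - (\<alpha>^2 + \<beta>^2)/2 is then largest at the top
    eigenvector of this quadratic form, with eigenvalue sqrt 5, where \<alpha>^2 + \<beta>^2 =
    2/sqrt 5.\<close>
  define \<beta> where "\<beta> = sqrt ((1 + sqrt 5) / 5)"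
  define c where "c = (9 - sqrt 5) / 10"
  define \<alpha> where "\<alpha> = 2 / (5 * \<beta>)"
  have s5: "sqrt 5 * sqrt 5 = 5" "sqrt 5 \<ge> 2" "sqrt 5 \<le> 3"
    by (auto intro: real_le_rsqrt real_le_lsqrt)
  have \<beta>: "\<beta> > 0" "\<beta> * \<beta> = (1 + sqrt 5) / 5"
    using s5 by (auto simp: \<beta>_def)
  \<comment> \<open>The numerators of \<open>c\<close> and \<gamma> are conjugate, with product 81 -
    5 = 76.\<close>
  have c\<beta>: "c = 1 - \<beta> * \<beta> / 2" and c0: "c \<ge> 0" and c\<gamma>: "c * \<gamma> = 2 / 5"
    using s5 unfolding \<beta>(2) by (auto simp: c_def \<gamma>_def field_simps)
  have \<alpha>\<beta>: "\<alpha> * \<beta> = 2 / 5" using \<beta> by (simp add: \<alpha>_def)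
  have \<alpha>2: "\<alpha> * \<alpha> = (sqrt 5 - 1) / 5"
  proof -
    have "\<alpha> * \<alpha> = 4 / (25 * (\<beta> * \<beta>))" by (simp add: \<alpha>_def)
    also have "25 * (\<beta> * \<beta>) = 5 * (1 + sqrt 5)" unfolding \<beta>(2) by simp
    also have "4 = (sqrt 5 - 1) * (1 + sqrt 5)" using s5 by (simp add: algebra_simps)
    also have "(sqrt 5 - 1) * (1 + sqrt 5) / (5 * (1 + sqrt 5)) = (sqrt 5 - 1) / 5"
      using s5(2) by (intro mult_divide_mult_cancel_right) linarith
    finally show ?thesis .
  qed
  define y where "y j = c * (w j * q (s j) j + \<gamma> * ?T (s j) j)" for j
  define v where "v i j = vec d (\<lambda>r. \<beta> * F i j r)" for i j
  define v0 where "v0 = vec d (\<lambda>r. \<alpha> * X r)"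
  have vv: "scalar_prod (v i j) (v i' k) = \<beta> * \<beta> * (if i = i' then ?h i j k else 0)"
    if "i \<in> M" "i' \<in> M" "j \<in> J" "k \<in> J" for i i' j k
  proof -
    have "scalar_prod (v i j) (v i' k) = \<beta> * \<beta> * (\<Sum>r<d. F i j r * F i' k r)"
      by (simp add: v_def scalar_prod_vec sum_distrib_left mult_ac)
    then show ?thesis unfolding F[OF that] .
  qed
  have v0v: "scalar_prod v0 (v i j) = 2 / 5 * (?T i j + (if i = s j then w j * q i j else 0))"
    if "j \<in> J" "i \<in> M" for i j
  proof -
    have "scalar_prod v0 (v i j) = \<alpha> * \<beta> * (\<Sum>r<d. X r * F i j r)"
      by (simp add: v_def v0_def scalar_prod_vec sum_distrib_left mult_ac)
    then show ?thesis unfolding \<alpha>\<beta> FX[OF that] .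
  qed
  have "sdp_feasible J M w p d y v0 v"
    unfolding sdp_feasible_def
  proof (intro conjI ballI impI)
    show "v0 \<in> carrier_vec d" by (simp add: v0_def)
    show "v i j \<in> carrier_vec d" for i j by (simp add: v_def)
  next
    fix j i assume j: "j \<in> J" and i: "i \<in> feasible_machines M p j"
    have iM: "i \<in> M" and pij: "p i j = ereal (q i j)" and q0: "q i j \<ge> 0" using feas[OF j i] by auto
    \<comment> \<open>Local optimality scaled by \<open>c\<close>, whose sign \<open>c0\<close>
      matters here.\<close>
    have "y j \<le> c * (w j * q i j + \<gamma> * ?T i j)"
      unfolding y_def q_def \<gamma>_def
      by (intro mult_left_mono local_optimum_inequality[OF inst opt s x j i] c0)
    also have "\<dots> = c * (w j * q i j) + (c * \<gamma>) * ?T i j" by (simp add: algebra_simps)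
    \<comment> \<open>Equality unless \<open>i = s j\<close>; there the self term of
      \<open>X\<close> adds nonnegative slack.\<close>
    also have "\<dots> \<le> c * (w j * q i j) + 2 / 5 * (?T i j + (if i = s j then w j * q i j else 0))"
      unfolding c\<gamma> using w[OF j] q0 by auto
    also have "\<dots> = w j * q i j + (- (1/2) * scalar_prod (v i j) (v i j) + scalar_prod v0 (v i j))"
      unfolding vv[OF iM iM j j] v0v[OF j iM] c\<beta> using w[OF j]
      by (simp add: interaction_self algebra_simps)
    finally show "ereal (y j) \<le> ereal (w j) * p i j
                      + ereal (- (1/2) * scalar_prod (v i j) (v i j) + scalar_prod v0 (v i j))"
      by (simp add: pij)
  next
    fix j k i i'
    assume j: "j \<in> J" and k: "k \<in> J" and i: "i \<in> feasible_machines M p j"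
      and i': "i' \<in> feasible_machines M p k"
    note vv' = vv[OF feas(1)[OF j i] feas(1)[OF k i'] j k]
    show "ereal (scalar_prod (v i j) (v i' k)) \<le>
          (if i = i'
           then ereal (w j * w k) * min (smith_ratio p w i j) (smith_ratio p w i k)
           else 0)"
    proof (cases "i = i'")
      case True
      have "?h i j k \<ge> 0"
        using interaction_nonneg w[OF j] w[OF k] feas(3)[OF j i] feas(3)[OF k i'] True by metis
      \<comment> \<open>Shrinking the Gram matrix by a factor of at most 1 keeps nonnegative
        interactions below their bounds.\<close>
      moreover have "\<beta> * \<beta> \<le> 1" unfolding \<beta>(2) using s5 by simp
      ultimately have "\<beta> * \<beta> * ?h i j k \<le> ?h i j k" using \<beta>(1) by (intro mult_left_le_one_le) auto
      then show ?thesis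
        using vv' True i' smith_ratio_interaction[OF inst j k i] by (simp add: q_def)
    qed (use vv' in simp)
  qed
  moreover have "ereal (4 / (5 + sqrt 5)) * cost J M w p prec x = ereal (sdp_objective J y v0)"
  proof -
    have "sdp_objective J y v0 = c * A + (c * \<gamma>) * B - \<alpha> * \<alpha> / 2 * (A + B)"
    proof -
      have "scalar_prod v0 v0 = \<alpha> * \<alpha> * (\<Sum>r<d. X r * X r)"
        by (simp add: v0_def scalar_prod_vec sum_distrib_left mult_ac)
      moreover have "sum y J = c * A + (c * \<gamma>) * B"
        by (simp add: y_def[abs_def] A_def B_def sum_distrib_left sum.distrib algebra_simps)
      ultimately show ?thesis by (simp add: sdp_objective_def XX)
    qed
    \<comment> \<open>The coefficients of \<open>A\<close> and \<open>B\<close> are 1 - sqrt 5 / 5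
      and half of it.\<close>
    also have "\<dots> = (1 - sqrt 5 / 5) * (A + B / 2)"
      unfolding c\<gamma> \<alpha>2 unfolding c_def by (simp add: field_simps)
    also have "1 - sqrt 5 / 5 = 4 / (5 + sqrt 5)"
    proof -
      have "5 + sqrt 5 \<noteq> 0" using s5 by linarith
      then show ?thesis using s5 by (simp add: field_simps)
    qed
    finally show ?thesis
      using cost_eq_interactions[OF inst ord s x] by (simp add: A_def B_def q_def)
  qed
  ultimately show ?thesis by (metis order_refl)
qed

end
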